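(* For each convex $d$-polytope $Q\subset\mathbb{R}^d$ and each finite set $G$ of labels (colors), the complex $\Omega(Q;G)$ admits a topological shelling.
   Context: Rainbow complex: let $Q\subset\mathbb{R}^d$ be a convex polytope with vertex set $\mathrm{vert}(Q)$ and let $G$ be a finite set. For each function $\omega:\mathrm{vert}(Q)\to G$ let $Q^\omega=\{(\mathfrak{t},\omega):\mathfrak{t}\in Q\}$ be a copy of $Q$ (the polytope $Q$ with each vertex $v$ labelled by $\omega(v)$). The space $\Omega(Q;G)$ is the quotient $$\Omega(Q;G)=\Big(\coprod_{\omega\in G^{\mathrm{vert}(Q)}}Q^\omega\Big)\Big/\approx$$ where $(\mathfrak{t},\omega)\approx(\mathfrak{s},\nu)$ if and only if $\mathfrak{t}=\mathfrak{s}$ and $\omega|_{\mathrm{vert}(F)}=\nu|_{\mathrm{vert}(F)}$, where $F\subseteq Q$ is the minimal face of $Q$ containing $\mathfrak{t}$. It is a finite regular cell complex whose closed cells are the vertex-colored polytopes $F^h$, with $F$ a nonempty face of $Q$ and $h:\mathrm{vert}(F)\to G$ (the image of $F\subseteq Q^\omega$ for any $\omega$ extending $h$); its maximal cells are the $Q^\omega$. Topological shelling: let $K$ be a finite regular cell complex. A total ordering $C_1,C_2,\ldots,C_k$ of its maximal (closed) cells is a topological shelling of $K$ if $\dim(C_1)\geq\dim(C_2)\geq\cdots\geq\dim(C_k)$ and for each $j>1$ either (a) or (b) holds: (a) $(\bigcup_{i<j}C_i)\cap C_j$ is a (non-empty) contractible subset of the boundary $\partial(C_j)$ of $C_j$;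 (b) $(\bigcup_{i<j}C_i)\cap C_j=\partial(C_j)$, where $\partial(C_j)\cong S^{\dim(C_j)-1}$ (with $S^{-1}=\emptyset$). *)

theory Defs
  imports "HOL-Analysis.Analysis"
begin

definition quotient_topology :: "'x topology \<Rightarrow> ('x \<times> 'x) set \<Rightarrow> 'x set topology" where
  "quotient_topology X r =
     topology (\<lambda>U. U \<subseteq> topspace X // r \<and> openin X {x \<in> topspace X. r `` {x} \<in> U})"

lemma openin_quotient_topology:
  "openin (quotient_topology X r) U \<longleftrightarrow>
     U \<subseteq> topspace X // r \<and> openin X {x \<in> topspace X. r `` {x} \<in> U}"
proof -
  have *: "{x \<in> topspace X. r `` {x} \<in> S \<inter> T} =
      {x \<in> topspace X. r `` {x} \<in> S} \<inter> {x \<in> topspace X. r `` {x} \<in> T}" for S T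
    by blast
  have **: "{x \<in> topspace X. r `` {x} \<in> \<Union>\<U>} = (\<Union>U\<in>\<U>. {x \<in> topspace X. r `` {x} \<in> U})" for \<U>
    by blast
  have "istopology (\<lambda>U. U \<subseteq> topspace X // r \<and> openin X {x \<in> topspace X. r `` {x} \<in> U})"
    unfolding istopology_def * ** by blast
  then show ?thesis
    by (simp add: quotient_topology_def)
qed

lemma topspace_quotient_topology: "topspace (quotient_topology X r) = topspace X // r"
proof
  show "topspace (quotient_topology X r) \<subseteq> topspace X // r"
    using openin_quotient_topology openin_topspace by blast
  have "{x \<in> topspace X. r `` {x} \<in> topspace X // r} = topspace X"
    by (auto intro: quotientI)
  then show "topspace X // r \<subseteq> topspace (quotient_topology X r)"
    by (intro openin_subset) (simp add: openin_quotient_topology)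
qed

lemma quotient_map_quotient_topology:
  "quotient_map X (quotient_topology X r) (\<lambda>x. r `` {x})"
  by (auto simp: quotient_map_def topspace_quotient_topology openin_quotient_topology quotient_def)


subsection \<open>Finite regular cell complexes\<close>

definition nball :: "nat \<Rightarrow> (nat \<Rightarrow> real) topology" where
  "nball n = subtopology (Euclidean_space n) {x. (\<Sum>i<n. (x i)\<^sup>2) \<le> 1}"

definition nball_boundary :: "nat \<Rightarrow> (nat \<Rightarrow> real) set" where
  "nball_boundary n = {x \<in> topspace (nball n). (\<Sum>i<n. (x i)\<^sup>2) = 1}"

definition is_cell :: "'x topology \<Rightarrow> 'x set \<Rightarrow> bool" where
  "is_cell X C \<longleftrightarrow> C \<subseteq> topspace X \<and> (\<exists>n. nball n homeomorphic_space subtopology X C)"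

text \<open>By invariance of domain, the dimension of a cell is well defined and every homeomorphism
  from the ball onto it carries the sphere to the same subset, so that the
  existential quantifiers in \<open>cell_boundary\<close> are independent of the choice of chart.
  The boundary of a 0-cell is empty.\<close>

definition cell_dim :: "'x topology \<Rightarrow> 'x set \<Rightarrow> nat" where
  "cell_dim X C = (THE n. nball n homeomorphic_space subtopology X C)"

definition cell_boundary :: "'x topology \<Rightarrow> 'x set \<Rightarrow> 'x set" where
  "cell_boundary X C =
     {y. \<exists>n f. homeomorphic_map (nball n) (subtopology X C) f \<and> y \<in> f ` nball_boundary n}"

text \<open>A complex is given by its underlying space together with its set of nonempty closed cells.
  Since there are finitely many compact cells, no separate condition relating the
  topology of the space to that of the cells is needed.\<close>

definition finite_regular_cell_complex :: "'x topology \<Rightarrow> 'x set set \<Rightarrow> bool" where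
  "finite_regular_cell_complex X K \<longleftrightarrow>
     Hausdorff_space X \<and> finite K \<and> (\<forall>C\<in>K. is_cell X C) \<and>
     (\<Union>C\<in>K. C - cell_boundary X C) = topspace X \<and>
     (\<forall>C\<in>K. \<forall>D\<in>K. C \<noteq> D \<longrightarrow> disjnt (C - cell_boundary X C) (D - cell_boundary X D)) \<and>
     (\<forall>C\<in>K. \<exists>L\<subseteq>K. cell_boundary X C = \<Union>L)"

definition maximal_cells :: "'x set set \<Rightarrow> 'x set set" where
  "maximal_cells K = {C \<in> K. \<forall>D\<in>K. C \<subseteq> D \<longrightarrow> D = C}"

definition topological_shelling :: "'x topology \<Rightarrow> 'x set set \<Rightarrow> 'x set list \<Rightarrow> bool" where
  "topological_shelling X K Cs \<longleftrightarrow>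
     finite_regular_cell_complex X K \<and>
     distinct Cs \<and> set Cs = maximal_cells K \<and>
     sorted_wrt (\<lambda>C D. cell_dim X C \<ge> cell_dim X D) Cs \<and>
     (\<forall>j. 0 < j \<and> j < length Cs \<longrightarrow>
        (let A = (\<Union>i<j. Cs ! i) \<inter> Cs ! j in
           A \<subseteq> cell_boundary X (Cs ! j) \<and> A \<noteq> {} \<and> contractible_space (subtopology X A)
         \<or> A = cell_boundary X (Cs ! j)))"


subsection \<open>The rainbow complex\<close>

definition vert :: "'a::euclidean_space set \<Rightarrow> 'a set" where
  "vert Q = {v. v extreme_point_of Q}"

definition min_face :: "'a::euclidean_space set \<Rightarrow> 'a \<Rightarrow> 'a set" where
  "min_face Q t = \<Inter>{F. F face_of Q \<and> t \<in> F}"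

definition labellings :: "'a::euclidean_space set \<Rightarrow> 'g set \<Rightarrow> ('a \<Rightarrow> 'g) set" where
  "labellings Q G = vert Q \<rightarrow>\<^sub>E G"

definition rainbow_rel ::
  "'a::euclidean_space set \<Rightarrow> 'g set \<Rightarrow> ((('a \<Rightarrow> 'g) \<times> 'a) \<times> (('a \<Rightarrow> 'g) \<times> 'a)) set" where
  "rainbow_rel Q G =
     {((\<omega>, t), (\<nu>, s)). \<omega> \<in> labellings Q G \<and> \<nu> \<in> labellings Q G \<and> t \<in> Q \<and> s \<in> Q \<and>
        t = s \<and> restrict \<omega> (vert (min_face Q t)) = restrict \<nu> (vert (min_face Q t))}"

definition rainbow_space ::
  "'a::euclidean_space set \<Rightarrow> 'g set \<Rightarrow> (('a \<Rightarrow> 'g) \<times> 'a) set topology" where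
  "rainbow_space Q G =
     quotient_topology (sum_topology (\<lambda>\<omega>. top_of_set Q) (labellings Q G)) (rainbow_rel Q G)"

text \<open>The closed cell \<open>F\<^sup>h\<close>, for a face \<open>F\<close> and \<open>h\<close> the restriction of the labelling \<open>\<omega>\<close> to
  the vertices of \<open>F\<close>; it depends on \<open>\<omega>\<close> only through \<open>h\<close>. Every \<open>h\<close> arises in this way,
  since a labelling of the vertices of a nonempty face exists only if \<open>G\<close> is nonempty.\<close>

definition rainbow_cell ::
  "'a::euclidean_space set \<Rightarrow> 'g set \<Rightarrow> 'a set \<Rightarrow> ('a \<Rightarrow> 'g) \<Rightarrow> (('a \<Rightarrow> 'g) \<times> 'a) set set" where
  "rainbow_cell Q G F \<omega> = (\<lambda>t. rainbow_rel Q G `` {(\<omega>, t)}) ` F"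

definition rainbow_cells ::
  "'a::euclidean_space set \<Rightarrow> 'g set \<Rightarrow> (('a \<Rightarrow> 'g) \<times> 'a) set set set" where
  "rainbow_cells Q G =
     {rainbow_cell Q G F \<omega> | F \<omega>. F face_of Q \<and> F \<noteq> {} \<and> \<omega> \<in> labellings Q G}"

end

theory Submission
  imports Defs
begin

text \<open>Fix a colour \<open>g\<close> and list the labellings \<open>\<omega>\<close> by increasing size of the support
  \<open>S = {v. \<omega> v \<noteq> g}\<close>. A point of the cell \<open>Q\<^sup>\<omega>\<close> lies in an earlier cell iff its minimal face
  misses some vertex of \<open>S\<close>: such a vertex can be recoloured by \<open>g\<close>, and conversely a different
  labelling agreeing with \<open>\<omega>\<close> on all of \<open>S\<close> has a larger support. If \<open>p\<close> lies in the relative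
  interior of the convex hull of \<open>S\<close>, the intersection with the earlier cells is therefore the
  union of the faces of \<open>Q\<close> not containing \<open>p\<close>. It is the whole boundary if \<open>p\<close> is a relative
  interior point of \<open>Q\<close>; otherwise radial projection from \<open>p\<close> makes it a retract of the starlike
  set \<open>Q - {p}\<close>.

  Each \<open>Q \<rightarrow> \<Omega>(Q;G)\<close> is an embedding, inverted by the projection to \<open>Q\<close>, so cells and
  their boundaries can be computed in \<open>Q\<close> by invariance of domain.\<close>

subsection \<open>Charts of compact convex sets\<close>

lemma nball_eq_top_of_set:
  "nball n = top_of_set {x. (\<forall>i\<ge>n. x i = 0) \<and> (\<Sum>i<n. (x i)\<^sup>2) \<le> 1}"
  unfolding nball_def Euclidean_space_def euclidean_product_topology subtopology_subtopology
  by (simp only: Collect_conj_eq)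

text \<open>Coordinates with respect to an orthonormal basis of an \<open>n\<close>-dimensional
  subspace give a linear isometry. This moves the ball from the function space used in the
  definition of cells to a Euclidean type, where invariance of domain is available.\<close>

lemma nball_homeomorphism:
  assumes "n \<le> DIM('b)"
  obtains S :: "'b::euclidean_space set" and f where "subspace S" "dim S = n"
    "homeomorphic_map (nball n) (top_of_set (cball 0 1 \<inter> S)) f"
    "f ` nball_boundary n = sphere 0 1 \<inter> S"
proof -
  obtain S :: "'b set" where S: "subspace S" "dim S = n"
    using choose_subspace_of_subspace[of n "UNIV :: 'b set"] assms by auto
  obtain B where B: "pairwise orthogonal B" "\<And>x. x \<in> B \<Longrightarrow> norm x = 1"
      "independent B" "card B = n" "span B = S"
    using orthonormal_basis_subspace[OF S(1)] S(2) by metis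
  have "finite B" using B(3) independent_imp_finite by auto
  then obtain e where e: "bij_betw e {..<n} B"
    using B(4) ex_bij_betw_nat_finite[of B] by (auto simp: atLeast0LessThan)
  have eB: "e i \<in> B" if "i < n" for i
    using e that by (auto simp: bij_betw_def)
  have orth: "e i \<bullet> e j = (if i = j then 1 else 0)" if "i < n" "j < n" for i j
  proof (cases "i = j")
    case True then show ?thesis using B(2)[OF eB[OF that(1)]] by (simp add: dot_square_norm)
  next
    case False
    then have "e i \<noteq> e j" using e that by (auto simp: bij_betw_def inj_on_def)
    then have "orthogonal (e i) (e j)" using B(1) eB that by (auto simp: pairwise_def)
    with False show ?thesis by (simp add: orthogonal_def)
  qed
  define f :: "(nat \<Rightarrow> real) \<Rightarrow> 'b" where "f = (\<lambda>x. \<Sum>i<n. x i *\<^sub>R e i)"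
  define g :: "'b \<Rightarrow> nat \<Rightarrow> real" where "g = (\<lambda>y i. if i < n then y \<bullet> e i else 0)"
  have f_inner: "f x \<bullet> e j = x j" if "j < n" for x j
  proof -
    have "f x \<bullet> e j = (\<Sum>i<n. if i = j then x i else 0)"
      unfolding f_def inner_sum_left by (rule sum.cong) (use orth that in auto)
    then show ?thesis using that by simp
  qed
  have gf: "g (f x) = x" if "\<forall>i\<ge>n. x i = 0" for x
    using that by (auto simp: g_def f_inner fun_eq_iff)
  have norm_f: "(norm (f x))\<^sup>2 = (\<Sum>i<n. (x i)\<^sup>2)" for x
  proof -
    have "(norm (f x))\<^sup>2 = f x \<bullet> f x" by (simp add: dot_square_norm)
    also have "\<dots> = (\<Sum>i<n. x i * (f x \<bullet> e i))"
      by (subst (2) f_def) (simp add: inner_sum_right)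
    finally show ?thesis by (simp add: f_inner power2_eq_square)
  qed
  have fS: "f x \<in> S" for x
    unfolding f_def B(5)[symmetric] by (intro span_sum span_scale span_base) (simp add: eB)
  have fg: "f (g y) = y" if "y \<in> S" for y
  proof -
    \<comment> \<open>The difference lies in \<open>span B\<close> and is orthogonal to
      \<open>B\<close>, hence orthogonal to itself.\<close>
    have "f (g y) - y \<in> S" using that fS S(1) by (simp add: subspace_diff)
    moreover have "orthogonal (f (g y) - y) b" if b: "b \<in> B" for b
    proof -
      obtain i where "i < n" "b = e i" using e b by (auto simp: bij_betw_def)
      then show ?thesis by (simp add: orthogonal_def inner_diff_left f_inner) (simp add: g_def)
    qed
    ultimately have "orthogonal (f (g y) - y) (f (g y) - y)"
      using B(5) orthogonal_to_span by blast
    then show ?thesis by (simp add: orthogonal_self)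
  qed
  have le1: "norm (f x) \<le> 1 \<longleftrightarrow> (\<Sum>i<n. (x i)\<^sup>2) \<le> 1" for x
    unfolding norm_f[symmetric] by (simp add: power_le_one_iff abs_square_le_1)
  have eq1: "norm (f x) = 1 \<longleftrightarrow> (\<Sum>i<n. (x i)\<^sup>2) = 1" for x
    unfolding norm_f[symmetric] by (simp add: power2_eq_1_iff) (smt (verit) norm_ge_zero)
  have g0: "\<forall>i\<ge>n. g y i = 0" for y by (simp add: g_def)
  have "homeomorphic_maps (nball n) (top_of_set (cball 0 1 \<inter> S)) f g"
    unfolding homeomorphic_maps_def nball_eq_top_of_set
  proof (intro conjI)
    have "continuous_on T f" for T
      unfolding f_def
      by (intro continuous_on_sum continuous_on_scaleR continuous_on_const
           continuous_on_subset[OF continuous_on_product_coordinates]) simp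
    then show "continuous_map (top_of_set {x. (\<forall>i\<ge>n. x i = 0) \<and> (\<Sum>i<n. (x i)\<^sup>2) \<le> 1})
        (top_of_set (cball 0 1 \<inter> S)) f"
      by (auto simp: le1 fS)
    have "continuous_on T g" for T
    proof (rule continuous_on_coordinatewise_then_product)
      show "continuous_on T (\<lambda>y. g y i)" for i
        by (cases "i < n") (auto simp: g_def intro: continuous_intros)
    qed
    moreover have "(\<Sum>i<n. (g y i)\<^sup>2) \<le> 1" if "y \<in> S" "norm y \<le> 1" for y
      using le1[of "g y"] fg that by simp
    ultimately show "continuous_map (top_of_set (cball 0 1 \<inter> S))
         (top_of_set {x. (\<forall>i\<ge>n. x i = 0) \<and> (\<Sum>i<n. (x i)\<^sup>2) \<le> 1}) g"
      by (auto simp: g0)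
  qed (auto simp: gf fg)
  then have "homeomorphic_map (nball n) (top_of_set (cball 0 1 \<inter> S)) f"
    using homeomorphic_maps_map by blast
  moreover have "f ` nball_boundary n = sphere 0 1 \<inter> S"
  proof
    show "f ` nball_boundary n \<subseteq> sphere 0 1 \<inter> S"
      using eq1 fS by (auto simp: nball_boundary_def nball_eq_top_of_set)
    show "sphere 0 1 \<inter> S \<subseteq> f ` nball_boundary n"
    proof
      fix y assume y: "y \<in> sphere 0 1 \<inter> S"
      then have "g y \<in> nball_boundary n"
        using eq1[of "g y"] fg[of y] g0[of y] by (simp add: nball_boundary_def nball_eq_top_of_set)
      with fg[of y] y show "y \<in> f ` nball_boundary n" by (metis Int_iff image_eqI)
    qed
  qed
  ultimately show thesis using that S by blast
qed

text \<open>Charts come with an arbitrary \<open>n\<close>; this bound is what allows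
  \<open>nball n\<close> to be modelled inside the type of \<open>F\<close>.\<close>

lemma nball_homeomorphic_dim_le:
  fixes F :: "'a::euclidean_space set"
  assumes "homeomorphic_map (nball n) (top_of_set F) f"
  shows "n \<le> DIM('a)"
proof (rule ccontr)
  assume n: "\<not> n \<le> DIM('a)"
  txt \<open>\<^typ>\<open>'a \<times> real\<close> has just enough dimension for a ball of dimension \<open>DIM('a) + 1\<close> inside
    \<open>nball n\<close>, so that invariance of dimension between Euclidean types applies.\<close>
  define k where "k = DIM('a \<times> real)"
  have k: "k \<le> n" "k = DIM('a) + 1" using n by (auto simp: k_def)
  have "k \<le> DIM('a \<times> real)" by (simp add: k_def)
  then obtain S :: "('a \<times> real) set" and h where S: "subspace S" "dim S = k"
    "homeomorphic_map (nball k) (top_of_set (cball 0 1 \<inter> S)) h"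
    by (rule nball_homeomorphism)
  have "S = UNIV" using S(1,2) dim_eq_full[of S] by (simp add: k_def span_eq_iff[THEN iffD2])
  then obtain h' where h': "homeomorphic_maps (nball k) (top_of_set (cball 0 1)) h h'"
    using S(3) homeomorphic_map_maps by fastforce
  have "(\<Sum>i<n. (x i)\<^sup>2) = (\<Sum>i<k. (x i)\<^sup>2)" if "\<forall>i\<ge>k. x i = 0" for x :: "nat \<Rightarrow> real"
    using k(1) that by (intro sum.mono_neutral_right) auto
  then have sub: "topspace (nball k) \<subseteq> topspace (nball n)"
    using k(1) by (auto simp: nball_eq_top_of_set)
  have h'': "homeomorphic_map (top_of_set (cball 0 1)) (nball k) h'"
    using h' homeomorphic_maps_map by blast
  have c: "continuous_on (cball 0 1) h'" "h' ` cball 0 1 = topspace (nball k)" "inj_on h' (cball 0 1)"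
    using homeomorphic_imp_continuous_map[OF h''] homeomorphic_imp_surjective_map[OF h'']
      homeomorphic_imp_injective_map[OF h'']
    by (simp_all add: nball_eq_top_of_set)
  have f: "continuous_on (topspace (nball n)) f" "inj_on f (topspace (nball n))"
    using homeomorphic_imp_continuous_map[OF assms] homeomorphic_imp_injective_map[OF assms]
    by (simp_all add: nball_eq_top_of_set)
  have "continuous_on (cball 0 1) (f \<circ> h')"
    using c sub by (intro continuous_on_compose) (auto intro: continuous_on_subset[OF f(1)])
  then have "continuous_on (ball 0 1) (f \<circ> h')"
    using ball_subset_cball continuous_on_subset by blast
  moreover have "inj_on (f \<circ> h') (cball 0 1)"
    using c sub by (intro comp_inj_on) (auto intro: inj_on_subset[OF f(2)])
  then have "inj_on (f \<circ> h') (ball 0 1)"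
    using ball_subset_cball inj_on_subset by blast
  ultimately have "DIM('a \<times> real) \<le> DIM('a)"
    by (intro invariance_of_dimension[of "ball 0 1" "f \<circ> h'"]) auto
  then show False by simp
qed

lemma homeomorphic_iff_homeomorphic_space:
  "S homeomorphic T \<longleftrightarrow> top_of_set S homeomorphic_space top_of_set T"
proof -
  have "homeomorphism S T f g \<longleftrightarrow> homeomorphic_maps (top_of_set S) (top_of_set T) f g" for f g
  proof -
    have "continuous_map (top_of_set S) (top_of_set T) f \<longleftrightarrow> continuous_on S f \<and> f ` S \<subseteq> T"
      "continuous_map (top_of_set T) (top_of_set S) g \<longleftrightarrow> continuous_on T g \<and> g ` T \<subseteq> S"
      by (auto simp: image_subset_iff_funcset)
    then show ?thesis
      unfolding homeomorphism_def homeomorphic_maps_def topspace_euclidean_subtopology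
      by (metis (no_types, lifting) image_subset_iff rev_image_eqI subsetI subset_antisym order_refl)
  qed
  then show ?thesis by (simp add: homeomorphic_def homeomorphic_space_def)
qed

section \<open>Homeomorphisms between convex sets\<close>

text \<open>Invariance of domain, which needs the comparison of dimensions, makes the image open in
  \<open>affine hull D\<close>. A subset of \<open>D\<close> with this property lies in the relative
  interior.\<close>

lemma homeomorphism_convex_rel_interior_subset:
  fixes C :: "'a::euclidean_space set" and D :: "'b::euclidean_space set"
  assumes "convex C" "convex D" "homeomorphic_map (top_of_set C) (top_of_set D) f"
    "aff_dim D \<le> aff_dim C"
  shows "f ` rel_interior C \<subseteq> rel_interior D"
proof -
  have f: "continuous_on C f" "inj_on f C" "f ` C = D"
    using assms(3) homeomorphic_imp_continuous_map[OF assms(3)]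
      homeomorphic_imp_injective_map[OF assms(3)] homeomorphic_imp_surjective_map[OF assms(3)] by auto
  note sub = rel_interior_subset[of C]
  have "openin (top_of_set (affine hull D)) (f ` rel_interior C)"
  proof (rule invariance_of_domain_affine_sets)
    show "continuous_on (rel_interior C) f" "inj_on f (rel_interior C)"
      using f sub continuous_on_subset inj_on_subset by blast+
    show "f \<in> rel_interior C \<rightarrow> affine hull D"
      using f sub hull_subset[of D affine] by blast
    show "openin (top_of_set (affine hull C)) (rel_interior C)" by (rule openin_rel_interior)
  qed (use assms(4) in auto)
  moreover have "f ` rel_interior C \<subseteq> D" using f sub by auto
  ultimately show ?thesis by (rule rel_interior_maximal[rotated])
qed

text \<open>The relative interior of \<open>C\<close> is nonempty and open in the affine hull, so
  invariance of dimension applies to it.\<close>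

lemma homeomorphism_convex_aff_dim_le:
  fixes C :: "'a::euclidean_space set" and D :: "'b::euclidean_space set"
  assumes "convex C" "C \<noteq> {}" "homeomorphic_map (top_of_set C) (top_of_set D) f"
  shows "aff_dim C \<le> aff_dim D"
proof -
  have f: "continuous_on C f" "inj_on f C" "f ` C = D"
    using homeomorphic_imp_continuous_map[OF assms(3)]
      homeomorphic_imp_injective_map[OF assms(3)] homeomorphic_imp_surjective_map[OF assms(3)] by auto
  note sub = rel_interior_subset[of C]
  have "aff_dim (affine hull C) \<le> aff_dim (affine hull D)"
  proof (rule invariance_of_dimension_affine_sets)
    show "continuous_on (rel_interior C) f" "inj_on f (rel_interior C)"
      using f sub continuous_on_subset inj_on_subset by blast+
    show "f \<in> rel_interior C \<rightarrow> affine hull D"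
      using f sub hull_subset[of D affine] by blast
    show "rel_interior C \<noteq> {}" using assms(1,2) rel_interior_eq_empty by blast
    show "openin (top_of_set (affine hull C)) (rel_interior C)" by (rule openin_rel_interior)
  qed auto
  then show ?thesis by simp
qed

text \<open>Invariance of dimension in both directions makes the affine dimensions equal; then the
  inclusion holds for \<open>f\<close> and for its inverse.\<close>

lemma homeomorphism_convex_rel_interior:
  fixes C :: "'a::euclidean_space set" and D :: "'b::euclidean_space set"
  assumes "convex C" "convex D" "homeomorphic_map (top_of_set C) (top_of_set D) f"
  shows "f ` rel_interior C = rel_interior D"
proof (cases "C = {}")
  case True
  then have "D = {}" using homeomorphic_imp_surjective_map[OF assms(3)] by simp
  with True show ?thesis by simp
next
  case False
  obtain g where fg: "homeomorphic_maps (top_of_set C) (top_of_set D) f g"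
    using assms(3) homeomorphic_map_maps by blast
  then have g: "homeomorphic_map (top_of_set D) (top_of_set C) g"
    using homeomorphic_maps_map by blast
  have "D \<noteq> {}" using False homeomorphic_imp_surjective_map[OF assms(3)] by auto
  then have "aff_dim C = aff_dim D"
    using False assms g by (intro antisym homeomorphism_convex_aff_dim_le) auto
  then have "f ` rel_interior C \<subseteq> rel_interior D" "g ` rel_interior D \<subseteq> rel_interior C"
    by (simp_all add: homeomorphism_convex_rel_interior_subset assms g)
  moreover have "f (g y) = y" if "y \<in> rel_interior D" for y
    using fg that rel_interior_subset[of D] by (auto simp: homeomorphic_maps_def)
  ultimately show ?thesis by (metis image_subset_iff subsetI subset_antisym image_eqI)
qed

lemma homeomorphism_convex_rel_frontier:
  fixes C :: "'a::euclidean_space set" and D :: "'b::euclidean_space set"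
  assumes "convex C" "compact C" "convex D" "compact D"
    "homeomorphic_map (top_of_set C) (top_of_set D) f"
  shows "f ` rel_frontier C = rel_frontier D"
proof -
  have f: "inj_on f C" "f ` C = D"
    using homeomorphic_imp_injective_map[OF assms(5)] homeomorphic_imp_surjective_map[OF assms(5)]
    by auto
  show ?thesis
    using homeomorphism_convex_rel_interior[OF assms(1,3,5)] f rel_interior_subset[of C] assms(2,4)
    by (simp add: rel_frontier_def closure_closed compact_imp_closed inj_on_image_set_diff)
qed

lemma rel_frontier_cball_Int_subspace:
  fixes S :: "'a::euclidean_space set"
  assumes "subspace S"
  shows "rel_frontier (cball 0 1 \<inter> S) = sphere 0 1 \<inter> S"
proof -
  have "rel_interior (cball 0 1 \<inter> S) = ball 0 1 \<inter> S"
    using assms subspace_0[OF assms]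
    by (subst rel_interior_convex_Int_affine)
      (auto simp: subspace_imp_affine simp flip: ex_in_conv intro!: exI[of _ 0])
  moreover have "closed (cball 0 1 \<inter> S)" using assms by (simp add: closed_Int closed_subspace)
  ultimately show ?thesis by (auto simp: rel_frontier_def)
qed

section \<open>Cells with a compact convex model\<close>

text \<open>Every chart has to be treated, because \<open>cell_boundary\<close> collects points from
  all of them. Composing with the model \<open>cball 0 1 \<inter> S\<close> of the ball leaves a
  homeomorphism of compact convex sets, which respects relative frontiers.\<close>

lemma nball_chart_convex:
  fixes F :: "'a::euclidean_space set"
  assumes "convex F" "compact F" "homeomorphic_map (nball n) (top_of_set F) f"
  shows "aff_dim F = int n" and "f ` nball_boundary n = rel_frontier F"
proof -
  have "n \<le> DIM('a)" using nball_homeomorphic_dim_le[OF assms(3)] .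
  then obtain S :: "'a set" and h where S: "subspace S" "dim S = n"
    "homeomorphic_map (nball n) (top_of_set (cball 0 1 \<inter> S)) h"
    "h ` nball_boundary n = sphere 0 1 \<inter> S"
    by (rule nball_homeomorphism)
  let ?B = "cball 0 1 \<inter> S"
  obtain k where hk: "homeomorphic_maps (nball n) (top_of_set ?B) h k"
    using S(3) homeomorphic_map_maps by blast
  then have "homeomorphic_map (top_of_set ?B) (nball n) k" using homeomorphic_maps_map by blast
  then have fk: "homeomorphic_map (top_of_set ?B) (top_of_set F) (f \<circ> k)"
    using assms(3) homeomorphic_map_compose by blast
  have B: "convex ?B" "compact ?B" "?B \<noteq> {}"
    using S(1) subspace_0[OF S(1)]
    by (auto simp: convex_Int subspace_imp_convex closed_subspace compact_Int_closed
        simp flip: ex_in_conv intro!: exI[of _ 0])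
  \<comment> \<open>The dimension is squeezed between that of \<open>S \<inter> ball 0 1\<close>,
    which is open in \<open>S\<close>, and that of \<open>S\<close>.\<close>
  have "aff_dim ?B = int n"
    using aff_dim_convex_Int_open[of S "ball 0 1"] S subspace_0[OF S(1)]
      aff_dim_subset[of "S \<inter> ball 0 1" ?B] aff_dim_subset[of ?B S]
    by (force simp: aff_dim_subspace subspace_imp_convex)
  moreover have "?B homeomorphic F"
    using homeomorphic_map_imp_homeomorphic_space[OF fk]
    by (simp add: homeomorphic_iff_homeomorphic_space)
  ultimately show "aff_dim F = int n"
    using homeomorphic_convex_sets[of ?B F] B assms by simp
  have "(f \<circ> k) ` (sphere 0 1 \<inter> S) = rel_frontier F"
    using homeomorphism_convex_rel_frontier[OF B(1,2) assms(1,2) fk]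
    by (simp add: rel_frontier_cball_Int_subspace S(1))
  moreover have "(f \<circ> k) ` (sphere 0 1 \<inter> S) = f ` nball_boundary n"
    using hk unfolding S(4)[symmetric]
    by (auto simp: homeomorphic_maps_def nball_boundary_def image_iff)
  ultimately show "f ` nball_boundary n = rel_frontier F" by simp
qed

text \<open>Compact convex sets of equal affine dimension are homeomorphic, so \<open>F\<close> can
  be compared with a ball in a subspace.\<close>

lemma nball_chart_exists:
  fixes F :: "'a::euclidean_space set"
  assumes "convex F" "compact F" "F \<noteq> {}"
  shows "\<exists>n f. homeomorphic_map (nball n) (top_of_set F) f"
proof -
  obtain n where n: "aff_dim F = int n"
    using assms(3) aff_dim_negative_iff[of F] by (metis linorder_not_less nonneg_int_cases)
  then have "n \<le> DIM('a)" using aff_dim_le_DIM[of F] by simp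
  then obtain S :: "'a set" and h where S: "subspace S" "dim S = n"
    "homeomorphic_map (nball n) (top_of_set (cball 0 1 \<inter> S)) h"
    by (rule nball_homeomorphism)
  let ?B = "cball 0 1 \<inter> S"
  have B: "convex ?B" "compact ?B"
    using S(1) by (auto simp: convex_Int subspace_imp_convex closed_subspace compact_Int_closed)
  have "aff_dim ?B = int n"
    using nball_chart_convex(1)[OF B S(3)] .
  then have "?B homeomorphic F"
    using homeomorphic_convex_compact_sets B assms n by metis
  then have "nball n homeomorphic_space top_of_set F"
    using homeomorphic_map_imp_homeomorphic_space[OF S(3)] homeomorphic_space_trans
    unfolding homeomorphic_iff_homeomorphic_space by blast
  then show ?thesis using homeomorphic_space by blast
qed

text \<open>Reads off the data of a cell from a convex set mapped onto it; the map \<open>e\<close>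
  will be an embedding \<open>rainbow_point\<close>.\<close>

lemma cell_of_convex_chart:
  fixes F :: "'a::euclidean_space set"
  assumes "convex F" "compact F" "F \<noteq> {}" "C \<subseteq> topspace X"
    and e: "homeomorphic_map (top_of_set F) (subtopology X C) e"
  shows "is_cell X C" and "cell_dim X C = nat (aff_dim F)"
    and "cell_boundary X C = e ` rel_frontier F"
proof -
  obtain m h where h: "homeomorphic_map (nball m) (top_of_set F) h"
    using nball_chart_exists assms by blast
  have eh: "homeomorphic_map (nball m) (subtopology X C) (e \<circ> h)"
    using h e homeomorphic_map_compose by blast
  then show "is_cell X C"
    using assms(4) homeomorphic_map_imp_homeomorphic_space unfolding is_cell_def by blast
  obtain e' where e': "homeomorphic_maps (top_of_set F) (subtopology X C) e e'"
    using e homeomorphic_map_maps by blast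
  \<comment> \<open>Pulling an arbitrary chart back to \<open>F\<close> along the inverse of
    \<open>e\<close> shows that dimension and boundary are the same for all charts. This settles
    both the \<open>THE\<close> in \<open>cell_dim\<close> and the existential in
    \<open>cell_boundary\<close>.\<close>
  have chart: "aff_dim F = int n \<and> f ` nball_boundary n = e ` rel_frontier F"
    if f: "homeomorphic_map (nball n) (subtopology X C) f" for n f
  proof -
    have "homeomorphic_map (subtopology X C) (top_of_set F) e'"
      using e' homeomorphic_maps_map by blast
    then have e'f: "homeomorphic_map (nball n) (top_of_set F) (e' \<circ> f)"
      using f homeomorphic_map_compose by blast
    have ee': "e (e' (f x)) = f x" if "x \<in> nball_boundary n" for x
    proof -
      have "f x \<in> topspace (subtopology X C)"
        using that homeomorphic_imp_surjective_map[OF f] by (auto simp: nball_boundary_def)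
      then show ?thesis using e' by (simp add: homeomorphic_maps_def)
    qed
    have "e ` rel_frontier F = e ` (e' \<circ> f) ` nball_boundary n"
      using nball_chart_convex(2)[OF assms(1,2) e'f] by simp
    also have "\<dots> = f ` nball_boundary n" using ee' by (auto simp: image_iff)
    finally show ?thesis using nball_chart_convex(1)[OF assms(1,2) e'f] by simp
  qed
  show "cell_dim X C = nat (aff_dim F)" unfolding cell_dim_def
  proof (rule the_equality)
    show "nball (nat (aff_dim F)) homeomorphic_space subtopology X C"
      using chart[OF eh] eh homeomorphic_map_imp_homeomorphic_space by force
    show "n = nat (aff_dim F)" if "nball n homeomorphic_space subtopology X C" for n
      using that chart by (metis homeomorphic_space nat_int)
  qed
  show "cell_boundary X C = e ` rel_frontier F"
    using chart eh unfolding cell_boundary_def by blast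
qed

subsection \<open>Faces of polytopes\<close>

context
  fixes Q :: "'a::euclidean_space set"
  assumes Q: "polytope Q"
begin

lemma min_face_face_of:
  assumes "t \<in> Q" shows "min_face Q t face_of Q"
  unfolding min_face_def using assms face_of_refl[OF polytope_imp_convex[OF Q]]
  by (intro face_of_Inter) auto

lemma mem_min_face: "t \<in> min_face Q t"
  by (simp add: min_face_def)

lemma min_face_subset: "F face_of Q \<Longrightarrow> t \<in> F \<Longrightarrow> min_face Q t \<subseteq> F"
  by (auto simp: min_face_def)

text \<open>Faces of faces are faces: a point of the relative frontier would lie on a proper face of
  \<open>min_face Q t\<close>, against minimality.\<close>

lemma rel_interior_min_face:
  assumes "t \<in> Q" shows "t \<in> rel_interior (min_face Q t)"
proof (rule ccontr)
  let ?M = "min_face Q t"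
  assume "t \<notin> rel_interior ?M"
  then have "t \<in> rel_frontier ?M"
    using mem_min_face closure_subset[of ?M] by (auto simp: rel_frontier_def)
  moreover have "polyhedron ?M"
    using face_of_polytope_polytope[OF Q min_face_face_of[OF assms]] by (rule polytope_imp_polyhedron)
  ultimately obtain F where F: "F face_of ?M" "F \<noteq> ?M" "t \<in> F"
    by (auto simp: rel_frontier_of_polyhedron_alt)
  then have "F face_of Q" using face_of_trans min_face_face_of[OF assms] by blast
  then show False using F min_face_subset[of F t] face_of_imp_subset[OF F(1)] by blast
qed

text \<open>Faces whose relative interiors meet coincide.\<close>

lemma min_face_eq:
  assumes "F face_of Q" "t \<in> rel_interior F" shows "min_face Q t = F"
proof -
  have "t \<in> Q" using assms face_of_imp_subset rel_interior_subset by blast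
  then show ?thesis
    using face_of_eq[OF min_face_face_of assms(1)] rel_interior_min_face assms(2) by blast
qed

lemma rel_frontier_polytope_eq: "rel_frontier Q = {t \<in> Q. min_face Q t \<noteq> Q}"
proof -
  have "rel_frontier Q = Q - rel_interior Q"
    using Q by (simp add: rel_frontier_def polytope_imp_closed closure_closed)
  moreover have "t \<in> rel_interior Q \<longleftrightarrow> min_face Q t = Q" if "t \<in> Q" for t
    using min_face_eq[of Q t] rel_interior_min_face[OF that] face_of_refl[OF polytope_imp_convex[OF Q]]
    by auto
  ultimately show ?thesis by blast
qed

text \<open>The set is the union of the finitely many faces not containing \<open>S\<close>. Its
  compactness serves the radial projection below and, through the complement, the open stars in the
  proof of the Hausdorff property.\<close>

lemma compact_min_face_not_superset: "compact {t \<in> Q. \<not> S \<subseteq> min_face Q t}"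
proof -
  have "{t \<in> Q. \<not> S \<subseteq> min_face Q t} = \<Union>{F. F face_of Q \<and> \<not> S \<subseteq> F}"
    using min_face_face_of mem_min_face min_face_subset face_of_imp_subset by blast
  moreover have "compact F" if "F face_of Q" for F
    using that Q face_of_imp_compact polytope_imp_compact polytope_imp_convex by blast
  moreover have "finite {F. F face_of Q \<and> \<not> S \<subseteq> F}"
    using finite_polytope_faces[OF Q] by (rule rev_finite_subset) auto
  ultimately show ?thesis by (metis (no_types, lifting) compact_Union mem_Collect_eq)
qed

text \<open>Turns incidence with faces into a condition along rays from \<open>p\<close>. Forwards,
  \<open>t\<close> is a relative interior point of its minimal face, so the segment from
  \<open>p\<close> can be prolonged inside that face. Backwards, \<open>t\<close> is interior to a
  segment in \<open>Q\<close> starting at \<open>p\<close>, and a face containing \<open>t\<close>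
  contains both endpoints.\<close>

lemma mem_min_face_iff:
  assumes p: "p \<in> Q" and t: "t \<in> Q" "t \<noteq> p"
  shows "p \<in> min_face Q t \<longleftrightarrow> (\<exists>k>1. p + k *\<^sub>R (t - p) \<in> Q)"
proof
  assume "p \<in> min_face Q t"
  then obtain u where u: "u > 1" "(1 - u) *\<^sub>R p + u *\<^sub>R t \<in> min_face Q t"
    using rel_interior_min_face[OF t(1)]
      convex_rel_interior_if2[of "min_face Q t" t] face_of_imp_convex[OF min_face_face_of[OF t(1)]]
      hull_subset
    by (metis (no_types, lifting) convex_rel_interior_if in_mono)
  then show "\<exists>k>1. p + k *\<^sub>R (t - p) \<in> Q"
    using face_of_imp_subset[OF min_face_face_of[OF t(1)]]
    by (intro exI[of _ u]) (auto simp: algebra_simps)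
next
  assume "\<exists>k>1. p + k *\<^sub>R (t - p) \<in> Q"
  then obtain k where k: "k > 1" "p + k *\<^sub>R (t - p) \<in> Q" (is "?q \<in> Q") by blast
  have "t \<in> open_segment p ?q"
  proof -
    have "p \<noteq> ?q" using k(1) t(2) by simp
    moreover have "t = (1 - 1 / k) *\<^sub>R p + (1 / k) *\<^sub>R ?q"
      using k(1) by (simp add: algebra_simps)
    ultimately show ?thesis using k(1) by (auto simp: in_segment intro!: exI[of _ "1/k"])
  qed
  then show "p \<in> min_face Q t"
    using min_face_face_of[OF t(1)] mem_min_face p k(2) unfolding face_of_def by blast
qed

text \<open>By \<open>mem_min_face_iff\<close>, the points of \<open>A\<close> are the last points
  of \<open>Q\<close> on the rays from \<open>p\<close> through \<open>Q - {p}\<close>. Each such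
  ray meets \<open>A\<close> exactly once, and sliding along it retracts \<open>Q - {p}\<close> onto
  \<open>A\<close>.\<close>

lemma contractible_faces_avoiding_point:
  assumes p: "p \<in> Q" "p \<notin> rel_interior Q"
  defines "A \<equiv> {t \<in> Q. p \<notin> min_face Q t}"
  shows "contractible A" and "A \<noteq> {}"
proof -
  have cQ: "convex Q" "compact Q" using Q polytope_imp_convex polytope_imp_compact by auto
  have pA: "p \<notin> A" using mem_min_face by (auto simp: A_def)
  have AQ: "A \<subseteq> Q" by (auto simp: A_def)
  \<comment> \<open>\<open>q\<close> is the star centre: the open segment from \<open>q\<close> to a
    point of \<open>Q\<close> stays in the relative interior, which misses \<open>p\<close>.\<close>
  obtain q where q: "q \<in> rel_interior Q" using rel_interior_eq_empty[OF cQ(1)] p(1) by blast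
  have "starlike (Q - {p})" unfolding starlike_def
  proof (intro bexI ballI)
    show "q \<in> Q - {p}" using q p(2) rel_interior_subset by blast
    show "closed_segment q x \<subseteq> Q - {p}" if x: "x \<in> Q - {p}" for x
    proof -
      have "open_segment q x \<subseteq> rel_interior Q"
        using rel_interior_closure_convex_segment[OF cQ(1) q] x closure_subset by blast
      then have "open_segment q x \<subseteq> Q - {p}" using p(2) rel_interior_subset by blast
      with x q p(2) rel_interior_subset[of Q] show ?thesis by (auto simp: closed_segment_eq_open)
    qed
  qed
  then have contr: "contractible (Q - {p})" by (rule starlike_imp_contractible)
  \<comment> \<open>Translating \<open>p\<close> to the origin prepares for
    \<open>continuous_on_compact_surface_projection\<close>: the compact set \<open>S\<close> will
    meet every ray of the cone \<open>K\<close> exactly once.\<close>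
  define V where "V = (\<lambda>x. x - p) ` Q"
  define K where "K = {c *\<^sub>R y | c y. 0 \<le> c \<and> y \<in> V}"
  define S where "S = (\<lambda>x. x - p) ` A"
  have "compact S"
  proof -
    have "A = {t \<in> Q. \<not> {p} \<subseteq> min_face Q t}" by (auto simp: A_def)
    then have "compact A" using compact_min_face_not_superset[of "{p}"] by simp
    then show ?thesis unfolding S_def by (intro compact_continuous_image continuous_intros)
  qed
  have "cone K" unfolding cone_def K_def
    by (auto, metis mult_nonneg_nonneg)
  have V: "z \<in> V \<longleftrightarrow> p + z \<in> Q" for z by (force simp: V_def image_iff algebra_simps)
  have VK: "V \<subseteq> K" unfolding K_def by (auto intro!: exI[of _ "1::real"])
  have S: "S \<subseteq> K - {0}" using VK pA AQ by (auto simp: S_def V_def)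
  have Siff: "y \<in> S \<longleftrightarrow> y \<in> V \<and> (\<forall>k>1. k *\<^sub>R y \<notin> V)" if "y \<noteq> 0" for y
  proof -
    have "y \<in> S \<longleftrightarrow> p + y \<in> A" by (force simp: S_def image_iff algebra_simps)
    also have "\<dots> \<longleftrightarrow> p + y \<in> Q \<and> \<not> (\<exists>k>1. p + k *\<^sub>R y \<in> Q)"
      using mem_min_face_iff[OF p(1), of "p + y"] that by (auto simp: A_def)
    finally show ?thesis by (auto simp: V)
  qed
  have ex: "\<exists>!k. 0 < k \<and> k *\<^sub>R y \<in> S" if y: "y \<in> K - {0}" for y
  proof -
    obtain c v where cv: "y = c *\<^sub>R v" "0 < c" "v \<in> V" "v \<noteq> 0"
      using y unfolding K_def by force
    \<comment> \<open>The largest parameter in \<open>T\<close> is where the ray through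
      \<open>y\<close> leaves \<open>V\<close>; the parameter \<open>1 / c\<close> shows that it
      exists and is positive.\<close>
    define T where "T = {k. 0 \<le> k \<and> k *\<^sub>R y \<in> V}"
    have cT: "1 / c \<in> T" using cv by (simp add: T_def)
    have "compact V" unfolding V_def using cQ(2) by (intro compact_continuous_image continuous_intros)
    have "closed T"
    proof -
      have "T = {0..} \<inter> (\<lambda>k. k *\<^sub>R y) -` V" by (auto simp: T_def)
      then show ?thesis using compact_imp_closed[OF \<open>compact V\<close>]
        by (auto intro!: closed_Int closed_vimage continuous_intros)
    qed
    moreover have "bounded T"
    proof -
      obtain B where B: "norm v \<le> B" if "v \<in> V" for v
        using compact_imp_bounded[OF \<open>compact V\<close>] bounded_iff by metis
      have "norm k \<le> B / norm y" if "k \<in> T" for k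
        using B[of "k *\<^sub>R y"] that y by (simp add: T_def pos_le_divide_eq)
      then show ?thesis using bounded_iff by blast
    qed
    ultimately have "compact T" using compact_eq_bounded_closed by blast
    then obtain m where m: "m \<in> T" "\<And>k. k \<in> T \<Longrightarrow> k \<le> m"
      using compact_attains_sup[of T] cT by blast
    have m0: "0 < m" using m(2)[OF cT] cv(2) by (smt (verit) divide_pos_pos)
    have "m *\<^sub>R y \<in> S"
    proof -
      have "k * m \<notin> T" if "k > 1" for k using m(2)[of "k * m"] m0 that by force
      then show ?thesis using m m0 y by (subst Siff) (auto simp: T_def)
    qed
    moreover have "k = m" if k: "0 < k" "k *\<^sub>R y \<in> S" for k
    proof -
      have kS: "k *\<^sub>R y \<in> V" "\<And>l. l > 1 \<Longrightarrow> (l * k) *\<^sub>R y \<notin> V"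
        using Siff[of "k *\<^sub>R y"] k y by auto
      have "k \<le> m" using m(2) kS(1) k(1) by (simp add: T_def)
      moreover have "\<not> k < m"
      proof
        assume "k < m"
        \<comment> \<open>Stretching \<open>k *\<^sub>R y\<close> by the factor
          \<open>m / k > 1\<close> would stay in \<open>V\<close>, so \<open>k *\<^sub>R y\<close>
          would not be the last point on its ray.\<close>
        then have "(m / k * k) *\<^sub>R y \<notin> V" using k(1) by (intro kS(2)) simp
        then show False using m(1) k(1) by (simp add: T_def)
      qed
      ultimately show ?thesis by simp
    qed
    ultimately show ?thesis using m0 by blast
  qed
  define d where "d = (\<lambda>y. THE k. 0 < k \<and> k *\<^sub>R y \<in> S)"
  have d: "0 < k \<and> k *\<^sub>R y \<in> S \<longleftrightarrow> d y = k" if "y \<in> K - {0}" for y k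
    using theI'[OF ex[OF that]] ex[OF that] unfolding d_def by blast
  have contd: "continuous_on (K - {0}) (\<lambda>y. d y *\<^sub>R y)"
    by (rule continuous_on_compact_surface_projection[OF \<open>compact S\<close> S \<open>cone K\<close> d])
  define r where "r = (\<lambda>x. p + d (x - p) *\<^sub>R (x - p))"
  have inK: "x - p \<in> K - {0}" if "x \<in> Q - {p}" for x using that VK by (auto simp: V_def)
  have rA: "r x \<in> A" if "x \<in> Q - {p}" for x
    using d[OF inK[OF that], of "d (x - p)"] by (auto simp: S_def r_def)
  have rid: "r x = x" if "x \<in> A" for x
  proof -
    have "d (x - p) = 1" using d[of "x - p" 1] inK[of x] that AQ pA by (auto simp: S_def)
    then show ?thesis by (simp add: r_def)
  qed
  have "continuous_on (Q - {p}) ((\<lambda>y. d y *\<^sub>R y) \<circ> (\<lambda>x. x - p))"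
    using inK by (intro continuous_on_compose continuous_intros continuous_on_subset[OF contd]) auto
  then have "continuous_on (Q - {p}) r"
    unfolding r_def o_def by (intro continuous_on_add continuous_on_const)
  then have "A retract_of (Q - {p})"
    unfolding retract_of_def retraction_def using rA rid AQ pA by auto
  then show "contractible A" using contr retract_of_contractible by blast
  show "A \<noteq> {}" using rA[of q] q p(2) rel_interior_subset by blast
qed

end

subsection \<open>The rainbow complex\<close>

text \<open>As a function of \<open>t\<close> this is the characteristic map of the maximal cell
  labelled by \<open>\<omega>\<close>.\<close>

definition rainbow_point ::
  "'a::euclidean_space set \<Rightarrow> 'g set \<Rightarrow> ('a \<Rightarrow> 'g) \<Rightarrow> 'a \<Rightarrow> (('a \<Rightarrow> 'g) \<times> 'a) set" where
  "rainbow_point Q G \<omega> t = rainbow_rel Q G `` {(\<omega>, t)}"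

lemma rainbow_cell_eq: "rainbow_cell Q G F \<omega> = rainbow_point Q G \<omega> ` F"
  by (simp add: rainbow_cell_def rainbow_point_def)

lemma vert_face: "F face_of Q \<Longrightarrow> vert F = vert Q \<inter> F"
  by (auto simp: vert_def extreme_point_of_face)

lemma equiv_rainbow_rel: "equiv (labellings Q G \<times> Q) (rainbow_rel Q G)"
  unfolding equiv_def rainbow_rel_def by (auto intro!: refl_onI symI transI)

lemma rainbow_point_eq_iff:
  assumes "\<omega> \<in> labellings Q G" "\<nu> \<in> labellings Q G" "t \<in> Q" "s \<in> Q"
  shows "rainbow_point Q G \<omega> t = rainbow_point Q G \<nu> s \<longleftrightarrow>
    t = s \<and> (\<forall>v\<in>vert (min_face Q t). \<omega> v = \<nu> v)"
proof -
  have "restrict \<omega> A = restrict \<nu> A \<longleftrightarrow> (\<forall>v\<in>A. \<omega> v = \<nu> v)" for A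
    by (auto simp: restrict_def fun_eq_iff)
  moreover have "rainbow_point Q G \<omega> t = rainbow_point Q G \<nu> s \<longleftrightarrow> ((\<omega>, t), (\<nu>, s)) \<in> rainbow_rel Q G"
    unfolding rainbow_point_def using assms by (intro eq_equiv_class_iff[OF equiv_rainbow_rel]) auto
  ultimately show ?thesis using assms by (auto simp: rainbow_rel_def)
qed

lemma topspace_rainbow_space:
  "topspace (rainbow_space Q G) = {rainbow_point Q G \<omega> t | \<omega> t. \<omega> \<in> labellings Q G \<and> t \<in> Q}"
  by (auto simp: rainbow_space_def topspace_quotient_topology quotient_def rainbow_point_def)

lemma openin_rainbow_space:
  "openin (rainbow_space Q G) U \<longleftrightarrow> U \<subseteq> topspace (rainbow_space Q G) \<and>
     (\<forall>\<omega>\<in>labellings Q G. openin (top_of_set Q) {t \<in> Q. rainbow_point Q G \<omega> t \<in> U})"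
  unfolding rainbow_space_def openin_quotient_topology topspace_quotient_topology openin_sum_topology
  by (auto simp: rainbow_point_def)

section \<open>Projection to the polytope and the Hausdorff property\<close>

text \<open>The choice is harmless, since equivalent pairs share their second component: on the
  quotient this is the map that forgets the labels.\<close>

definition rainbow_proj :: "(('a \<Rightarrow> 'g) \<times> 'a) set \<Rightarrow> 'a" where
  "rainbow_proj P = snd (SOME p. p \<in> P)"

lemma rainbow_proj_point:
  assumes "\<omega> \<in> labellings Q G" "t \<in> Q"
  shows "rainbow_proj (rainbow_point Q G \<omega> t) = t"
proof -
  have "(\<omega>, t) \<in> rainbow_point Q G \<omega> t"
    using assms by (simp add: rainbow_point_def rainbow_rel_def)
  then have "(SOME p. p \<in> rainbow_point Q G \<omega> t) \<in> rainbow_point Q G \<omega> t" by (rule someI)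
  then show ?thesis by (auto simp: rainbow_proj_def rainbow_point_def rainbow_rel_def)
qed

lemma continuous_map_rainbow_proj: "continuous_map (rainbow_space Q G) (top_of_set Q) rainbow_proj"
  unfolding continuous_map_alt
proof (intro conjI allI impI)
  show "rainbow_proj \<in> topspace (rainbow_space Q G) \<rightarrow> topspace (top_of_set Q)"
    by (auto simp: topspace_rainbow_space rainbow_proj_point)
  fix U assume U: "openin (top_of_set Q) U"
  have "{t \<in> Q. rainbow_point Q G \<omega> t \<in> rainbow_proj -` U \<inter> topspace (rainbow_space Q G)} = U"
    if "\<omega> \<in> labellings Q G" for \<omega>
    using that openin_imp_subset[OF U]
    by (auto simp: rainbow_proj_point topspace_rainbow_space)
  then show "openin (rainbow_space Q G) (rainbow_proj -` U \<inter> topspace (rainbow_space Q G))"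
    using U by (simp add: openin_rainbow_space)
qed

lemma continuous_map_rainbow_point:
  assumes "\<omega> \<in> labellings Q G"
  shows "continuous_map (top_of_set Q) (rainbow_space Q G) (rainbow_point Q G \<omega>)"
  unfolding continuous_map_alt
proof (intro conjI allI impI)
  show "rainbow_point Q G \<omega> \<in> topspace (top_of_set Q) \<rightarrow> topspace (rainbow_space Q G)"
    using assms by (auto simp: topspace_rainbow_space)
  fix U assume "openin (rainbow_space Q G) U"
  then have "openin (top_of_set Q) {t \<in> Q. rainbow_point Q G \<omega> t \<in> U}"
    using assms by (simp add: openin_rainbow_space)
  moreover have "{t \<in> Q. rainbow_point Q G \<omega> t \<in> U} = rainbow_point Q G \<omega> -` U \<inter> topspace (top_of_set Q)"
    by auto
  ultimately show "openin (top_of_set Q) (rainbow_point Q G \<omega> -` U \<inter> topspace (top_of_set Q))"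
    by simp
qed

text \<open>The forgetful map \<open>rainbow_proj\<close> is a continuous inverse on the image, the
  same one for all labellings.\<close>

lemma homeomorphic_map_rainbow_point:
  assumes "\<omega> \<in> labellings Q G" "F \<subseteq> Q"
  shows "homeomorphic_map (top_of_set F)
    (subtopology (rainbow_space Q G) (rainbow_point Q G \<omega> ` F)) (rainbow_point Q G \<omega>)"
proof -
  have "continuous_map (top_of_set F) (rainbow_space Q G) (rainbow_point Q G \<omega>)"
    using continuous_map_from_subtopology[OF continuous_map_rainbow_point[OF assms(1)], of F] assms(2)
    by (simp add: subtopology_subtopology Int_absorb1)
  moreover have "continuous_map (subtopology (rainbow_space Q G) (rainbow_point Q G \<omega> ` F))
      euclidean rainbow_proj"
    using continuous_map_rainbow_proj[of Q G] by (auto intro: continuous_map_from_subtopology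
        simp: continuous_map_in_subtopology)
  ultimately have "homeomorphic_maps (top_of_set F)
    (subtopology (rainbow_space Q G) (rainbow_point Q G \<omega> ` F)) (rainbow_point Q G \<omega>) rainbow_proj"
    using assms rainbow_proj_point[OF assms(1)] unfolding homeomorphic_maps_def
    by (auto simp: continuous_map_in_subtopology subset_iff)
  then show ?thesis using homeomorphic_maps_map by blast
qed

lemma rainbow_point_inj_on: "\<omega> \<in> labellings Q G \<Longrightarrow> inj_on (rainbow_point Q G \<omega>) Q"
  by (metis inj_onI rainbow_proj_point)

text \<open>Points over different points of \<open>Q\<close> are separated by the projection.
  Different points over the same \<open>t\<close> disagree in the colour of some vertex of
  \<open>min_face Q t\<close> and are separated by the open stars of the two colourings of this
  face.\<close>

lemma Hausdorff_rainbow_space: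
  assumes Q: "polytope Q" shows "Hausdorff_space (rainbow_space Q G)"
  unfolding Hausdorff_space_def
proof (intro allI impI, elim conjE)
  let ?Y = "rainbow_space Q G" and ?p = "rainbow_point Q G" and ?L = "labellings Q G"
  fix x y assume x: "x \<in> topspace ?Y" and y: "y \<in> topspace ?Y" and xy: "x \<noteq> y"
  obtain \<omega> t \<nu> s where w: "x = ?p \<omega> t" "y = ?p \<nu> s" "\<omega> \<in> ?L" "\<nu> \<in> ?L" "t \<in> Q" "s \<in> Q"
    using x y by (auto simp: topspace_rainbow_space)
  show "\<exists>U V. openin ?Y U \<and> openin ?Y V \<and> x \<in> U \<and> y \<in> V \<and> disjnt U V"
  proof (cases "t = s")
    case False
    have "Hausdorff_space (top_of_set Q)" by (simp add: Hausdorff_space_subtopology)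
    then obtain U V where UV: "openin (top_of_set Q) U" "openin (top_of_set Q) V" "t \<in> U" "s \<in> V" "disjnt U V"
      using False w(5,6) unfolding Hausdorff_space_def topspace_euclidean_subtopology by meson
    let ?r = "\<lambda>U. rainbow_proj -` U \<inter> topspace ?Y"
    have "openin ?Y (?r U)" "openin ?Y (?r V)"
      using UV continuous_map_rainbow_proj[of Q G] by (auto simp: continuous_map_alt)
    moreover have "x \<in> ?r U" "y \<in> ?r V" "disjnt (?r U) (?r V)"
      using UV w x y by (auto simp: rainbow_proj_point disjnt_def)
    ultimately show ?thesis by blast
  next
    case True
    let ?M = "min_face Q t"
    define N where "N = {z \<in> Q. ?M \<subseteq> min_face Q z}"
    \<comment> \<open>\<open>W h\<close> is the open star of the face \<open>?M\<close> coloured by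
      \<open>h\<close>.\<close>
    define W where "W h = {?p \<mu> z | \<mu> z. \<mu> \<in> ?L \<and> z \<in> N \<and> (\<forall>v\<in>vert ?M. \<mu> v = h v)}" for h :: "'a \<Rightarrow> 'b"
    \<comment> \<open>Over \<open>N\<close> the equivalence class determines the colours of all
      vertices of \<open>?M\<close>, so membership in \<open>W h\<close> can be tested on any
      representative.\<close>
    have sub: "vert ?M \<subseteq> vert (min_face Q z)" if "z \<in> N" for z
      using that w(5) vert_face min_face_face_of[OF Q] unfolding N_def by blast
    have "openin (top_of_set Q) N"
    proof -
      have "N = Q - {z \<in> Q. \<not> ?M \<subseteq> min_face Q z}" by (auto simp: N_def)
      then show ?thesis
        using compact_min_face_not_superset[OF Q, of ?M]
        by (metis (no_types, lifting) Diff_eq compact_imp_closed open_Compl openin_open_Int)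
    qed
    have W: "?p \<mu> z \<in> W h \<longleftrightarrow> z \<in> N \<and> (\<forall>v\<in>vert ?M. \<mu> v = h v)" if "\<mu> \<in> ?L" "z \<in> Q" for \<mu> z h
    proof
      assume "?p \<mu> z \<in> W h"
      then obtain \<mu>' z' where m: "?p \<mu> z = ?p \<mu>' z'" "\<mu>' \<in> ?L" "z' \<in> N" "\<forall>v\<in>vert ?M. \<mu>' v = h v"
        unfolding W_def by auto
      moreover from m have "z' \<in> Q" by (simp add: N_def)
      ultimately show "z \<in> N \<and> (\<forall>v\<in>vert ?M. \<mu> v = h v)"
        using rainbow_point_eq_iff[OF that(1) m(2) that(2)] sub by (metis in_mono)
    qed (use that in \<open>auto simp: W_def\<close>)
    have "openin ?Y (W h)" for h
    proof -
      have "W h \<subseteq> topspace ?Y" unfolding W_def topspace_rainbow_space N_def by blast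
      moreover have "{z \<in> Q. ?p \<mu> z \<in> W h} = (if \<forall>v\<in>vert ?M. \<mu> v = h v then N else {})" if "\<mu> \<in> ?L" for \<mu>
        using W[OF that] by (auto simp: N_def)
      ultimately show ?thesis using \<open>openin (top_of_set Q) N\<close> by (simp add: openin_rainbow_space)
    qed
    moreover have "x \<in> W \<omega>" "y \<in> W \<nu>"
      using w True W by (auto simp: N_def)
    moreover have "disjnt (W \<omega>) (W \<nu>)"
    proof (rule ccontr)
      assume "\<not> disjnt (W \<omega>) (W \<nu>)"
      then obtain \<mu> z where "\<mu> \<in> ?L" "z \<in> N" "?p \<mu> z \<in> W \<omega>" "?p \<mu> z \<in> W \<nu>"
        unfolding disjnt_def W_def by blast
      then have "\<forall>v\<in>vert ?M. \<omega> v = \<nu> v" using W[of \<mu> z] by (auto simp: N_def)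
      then show False using xy w True rainbow_point_eq_iff by metis
    qed
    ultimately show ?thesis by blast
  qed
qed

section \<open>The cell structure\<close>

context
  fixes Q :: "'a::euclidean_space set" and G :: "'g set"
  assumes Q: "polytope Q"
begin

lemma rainbow_cell_structure:
  assumes F: "F face_of Q" "F \<noteq> {}" and w: "\<omega> \<in> labellings Q G"
  shows "is_cell (rainbow_space Q G) (rainbow_cell Q G F \<omega>)"
    and "cell_dim (rainbow_space Q G) (rainbow_cell Q G F \<omega>) = nat (aff_dim F)"
    and "cell_boundary (rainbow_space Q G) (rainbow_cell Q G F \<omega>) = rainbow_point Q G \<omega> ` rel_frontier F"
proof -
  have FQ: "F \<subseteq> Q" "convex F" "compact F"
    using face_of_imp_subset[OF F(1)] face_of_imp_convex[OF F(1)]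
      face_of_imp_compact[OF polytope_imp_convex[OF Q] polytope_imp_compact[OF Q] F(1)] by simp_all
  have "rainbow_cell Q G F \<omega> \<subseteq> topspace (rainbow_space Q G)"
    using w FQ(1) by (auto simp: rainbow_cell_eq topspace_rainbow_space)
  note c = cell_of_convex_chart[OF FQ(2,3) F(2) this
      homeomorphic_map_rainbow_point[OF w FQ(1), folded rainbow_cell_eq]]
  show "is_cell (rainbow_space Q G) (rainbow_cell Q G F \<omega>)"
    and "cell_dim (rainbow_space Q G) (rainbow_cell Q G F \<omega>) = nat (aff_dim F)"
    and "cell_boundary (rainbow_space Q G) (rainbow_cell Q G F \<omega>) = rainbow_point Q G \<omega> ` rel_frontier F"
    using c by auto
qed

lemma rainbow_open_cell:
  assumes F: "F face_of Q" "F \<noteq> {}" and w: "\<omega> \<in> labellings Q G"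
  shows "rainbow_cell Q G F \<omega> - cell_boundary (rainbow_space Q G) (rainbow_cell Q G F \<omega>) =
    rainbow_point Q G \<omega> ` rel_interior F"
proof -
  have FQ: "F \<subseteq> Q" "closed F"
    using face_of_imp_subset[OF F(1)] compact_imp_closed
      face_of_imp_compact[OF polytope_imp_convex[OF Q] polytope_imp_compact[OF Q] F(1)] by simp_all
  then have "rel_interior F = F - rel_frontier F" "rel_frontier F \<subseteq> F"
    using rel_interior_subset[of F] by (auto simp: rel_frontier_def)
  then show ?thesis
    using rainbow_cell_structure(3)[OF F w] inj_on_image_set_diff[OF rainbow_point_inj_on[OF w], of F "rel_frontier F"] FQ(1)
    unfolding rainbow_cell_eq by (metis Diff_subset subset_trans)
qed

lemma finite_labellings: "finite G \<Longrightarrow> finite (labellings Q G)"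
  unfolding labellings_def vert_def
  using finite_polyhedron_extreme_points polytope_imp_polyhedron[OF Q] by (intro finite_PiE) auto

text \<open>The class of a point over \<open>t\<close> records only the colours on its minimal face,
  and for \<open>t\<close> in \<open>F\<close> that face lies in \<open>F\<close>.\<close>

lemma rainbow_cell_cong:
  assumes F: "F face_of Q" and "\<omega> \<in> labellings Q G" "\<nu> \<in> labellings Q G"
    and "\<And>v. v \<in> vert F \<Longrightarrow> \<omega> v = \<nu> v"
  shows "rainbow_cell Q G F \<omega> = rainbow_cell Q G F \<nu>"
  unfolding rainbow_cell_eq
proof (rule image_cong[OF refl])
  fix t assume t: "t \<in> F"
  then have tQ: "t \<in> Q" using F face_of_imp_subset by blast
  have "vert (min_face Q t) \<subseteq> vert F"
    using vert_face[OF min_face_face_of[OF Q tQ]] vert_face[OF F] min_face_subset[OF Q F t] by blast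
  then show "rainbow_point Q G \<omega> t = rainbow_point Q G \<nu> t"
    using assms tQ by (subst rainbow_point_eq_iff) auto
qed

text \<open>The open cells are the images of relative interiors of faces. Each point of
  \<open>Q\<close> lies in the relative interior of exactly one face, its minimal face, and the
  class fixes the colours there; hence the open cells partition the space.\<close>

lemma finite_regular_cell_complex_rainbow:
  assumes "finite G"
  shows "finite_regular_cell_complex (rainbow_space Q G) (rainbow_cells Q G)"
  unfolding finite_regular_cell_complex_def
proof (intro conjI ballI impI)
  let ?Y = "rainbow_space Q G" and ?p = "rainbow_point Q G" and ?L = "labellings Q G"
  let ?K = "rainbow_cells Q G"
  show "Hausdorff_space ?Y" by (rule Hausdorff_rainbow_space[OF Q])
  have "?K = (\<lambda>(F, \<omega>). rainbow_cell Q G F \<omega>) ` ({F. F face_of Q \<and> F \<noteq> {}} \<times> ?L)"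
    unfolding rainbow_cells_def by auto
  moreover have "finite {F. F face_of Q \<and> F \<noteq> {}}"
    using finite_polytope_faces[OF Q] by (rule rev_finite_subset) auto
  ultimately show "finite ?K" using finite_labellings[OF assms] by simp
  show "is_cell ?Y C" if "C \<in> ?K" for C
    using that rainbow_cell_structure(1) unfolding rainbow_cells_def by blast
  show "(\<Union>C\<in>?K. C - cell_boundary ?Y C) = topspace ?Y"
  proof
    show "(\<Union>C\<in>?K. C - cell_boundary ?Y C) \<subseteq> topspace ?Y"
      unfolding rainbow_cells_def rainbow_cell_eq topspace_rainbow_space
      using face_of_imp_subset by blast
    show "topspace ?Y \<subseteq> (\<Union>C\<in>?K. C - cell_boundary ?Y C)"
    proof
      fix x assume "x \<in> topspace ?Y"
      then obtain \<omega> t where w: "x = ?p \<omega> t" "\<omega> \<in> ?L" "t \<in> Q" by (auto simp: topspace_rainbow_space)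
      let ?C = "rainbow_cell Q G (min_face Q t) \<omega>"
      have M: "min_face Q t face_of Q" "min_face Q t \<noteq> {}"
        using min_face_face_of[OF Q w(3)] mem_min_face[OF Q] by auto
      then have "?C \<in> ?K" using w unfolding rainbow_cells_def by blast
      moreover have "x \<in> ?C - cell_boundary ?Y ?C"
        using rainbow_open_cell[OF M w(2)] rel_interior_min_face[OF Q w(3)] w(1) by blast
      ultimately show "x \<in> (\<Union>C\<in>?K. C - cell_boundary ?Y C)" by blast
    qed
  qed
  show "disjnt (C - cell_boundary ?Y C) (D - cell_boundary ?Y D)" if CD: "C \<in> ?K" "D \<in> ?K" "C \<noteq> D" for C D
  proof (rule ccontr)
    assume nd: "\<not> disjnt (C - cell_boundary ?Y C) (D - cell_boundary ?Y D)"
    obtain F \<omega> H \<nu> where C: "C = rainbow_cell Q G F \<omega>" "F face_of Q" "F \<noteq> {}" "\<omega> \<in> ?L"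
      and D: "D = rainbow_cell Q G H \<nu>" "H face_of Q" "H \<noteq> {}" "\<nu> \<in> ?L"
      using CD unfolding rainbow_cells_def by blast
    obtain t s where ts: "t \<in> rel_interior F" "s \<in> rel_interior H" "?p \<omega> t = ?p \<nu> s"
      using nd rainbow_open_cell[OF C(2-4)] rainbow_open_cell[OF D(2-4)]
      unfolding C(1) D(1) disjnt_def by auto
    have "t \<in> Q" "s \<in> Q"
      using ts C(2) D(2) face_of_imp_subset rel_interior_subset by blast+
    then have "t = s" "\<forall>v\<in>vert (min_face Q t). \<omega> v = \<nu> v"
      using rainbow_point_eq_iff[OF C(4) D(4)] ts(3) by auto
    moreover have "min_face Q t = F" "min_face Q s = H"
      using min_face_eq[OF Q] ts C(2) D(2) by auto
    ultimately have "C = D"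
      using rainbow_cell_cong[OF C(2,4) D(4)] C(1) D(1) by auto
    then show False using CD(3) by simp
  qed
  show "\<exists>L\<subseteq>?K. cell_boundary ?Y C = \<Union> L" if C': "C \<in> ?K" for C
  proof -
    obtain F \<omega> where C: "C = rainbow_cell Q G F \<omega>" "F face_of Q" "F \<noteq> {}" "\<omega> \<in> ?L"
      using C' unfolding rainbow_cells_def by blast
    \<comment> \<open>The proper nonempty faces of \<open>F\<close>, with the labelling kept, cover
      the boundary; the family is empty when \<open>F\<close> is a point.\<close>
    let ?L = "(\<lambda>H. rainbow_cell Q G H \<omega>) ` {H. H face_of F \<and> H \<noteq> F \<and> H \<noteq> {}}"
    have "?L \<subseteq> ?K" using C face_of_trans unfolding rainbow_cells_def by blast
    moreover have "rel_frontier F = \<Union>{H. H face_of F \<and> H \<noteq> F \<and> H \<noteq> {}}"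
      using face_of_polytope_polytope[OF Q C(2)] polytope_imp_polyhedron
      by (subst rel_frontier_of_polyhedron_alt) auto
    then have "cell_boundary ?Y C = ?p \<omega> ` \<Union>{H. H face_of F \<and> H \<noteq> F \<and> H \<noteq> {}}"
      using rainbow_cell_structure(3)[OF C(2-4)] unfolding C(1) by simp
    then have "cell_boundary ?Y C = \<Union>?L"
      unfolding rainbow_cell_eq by (simp add: image_Union)
    ultimately show ?thesis by blast
  qed
qed

section \<open>Maximal cells\<close>

text \<open>A relative interior point of \<open>Q\<close> has minimal face \<open>Q\<close>, so its
  class determines the whole labelling. This yields both the maximality of the full cells and their
  distinctness in the shelling.\<close>

lemma rainbow_cell_full_inj:
  assumes "\<omega> \<in> labellings Q G" "\<nu> \<in> labellings Q G" "F face_of Q" "Q \<noteq> {}"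
    and sub: "rainbow_cell Q G Q \<omega> \<subseteq> rainbow_cell Q G F \<nu>"
  shows "F = Q \<and> \<omega> = \<nu>"
proof -
  obtain q where q: "q \<in> rel_interior Q"
    using rel_interior_eq_empty[OF polytope_imp_convex[OF Q]] assms(4) by blast
  then have qQ: "q \<in> Q" using rel_interior_subset by blast
  have m: "min_face Q q = Q"
    using min_face_eq[OF Q face_of_refl q] polytope_imp_convex[OF Q] by blast
  obtain t where t: "t \<in> F" "rainbow_point Q G \<omega> q = rainbow_point Q G \<nu> t"
    using sub qQ by (auto simp: rainbow_cell_eq)
  have tQ: "t \<in> Q" using t(1) assms(3) face_of_imp_subset by blast
  have eq: "q = t" "\<forall>v\<in>vert Q. \<omega> v = \<nu> v"
    using rainbow_point_eq_iff[OF assms(1,2) qQ tQ] t(2) m by auto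
  then have "\<omega> = \<nu>"
    using assms(1,2) unfolding labellings_def by (intro PiE_ext) auto
  moreover have "F = Q"
    using min_face_subset[OF Q assms(3), of q] m t(1) eq(1) face_of_imp_subset[OF assms(3)] by auto
  ultimately show ?thesis by simp
qed

lemma maximal_cells_rainbow:
  assumes "Q \<noteq> {}"
  shows "maximal_cells (rainbow_cells Q G) = rainbow_cell Q G Q ` labellings Q G"
proof -
  note QQ = face_of_refl[OF polytope_imp_convex[OF Q]]
  have K: "rainbow_cell Q G Q \<omega> \<in> rainbow_cells Q G" if "\<omega> \<in> labellings Q G" for \<omega>
    unfolding rainbow_cells_def using that assms QQ by blast
  have "rainbow_cell Q G Q \<omega> \<in> maximal_cells (rainbow_cells Q G)" if w: "\<omega> \<in> labellings Q G" for \<omega>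
    unfolding maximal_cells_def
  proof (intro CollectI conjI ballI impI K[OF w])
    fix D assume D: "D \<in> rainbow_cells Q G" "rainbow_cell Q G Q \<omega> \<subseteq> D"
    then obtain F \<nu> where F: "D = rainbow_cell Q G F \<nu>" "F face_of Q" "\<nu> \<in> labellings Q G"
      unfolding rainbow_cells_def by blast
    then show "D = rainbow_cell Q G Q \<omega>"
      using rainbow_cell_full_inj[OF w F(3,2) assms] D(2) by auto
  qed
  moreover have "C \<in> rainbow_cell Q G Q ` labellings Q G" if C: "C \<in> maximal_cells (rainbow_cells Q G)" for C
  proof -
    obtain F \<omega> where F: "C = rainbow_cell Q G F \<omega>" "F face_of Q" "\<omega> \<in> labellings Q G"
      using C unfolding maximal_cells_def rainbow_cells_def by blast
    then have "C \<subseteq> rainbow_cell Q G Q \<omega>"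
      using face_of_imp_subset[OF F(2)] by (auto simp: rainbow_cell_eq)
    then show ?thesis using C K[OF F(3)] F(3) by (auto simp: maximal_cells_def)
  qed
  ultimately show ?thesis by auto
qed

section \<open>The order of the cells and the shape of the intersections\<close>

text \<open>The left side of the equivalence says that the point of the \<open>j\<close>-th cell
  over \<open>t\<close> lies in an earlier cell. The last property provides a nonempty support, in
  whose convex hull a point \<open>p\<close> can be chosen.\<close>

lemma rainbow_labelling_order:
  assumes "finite G" "g \<in> G"
  obtains ws where "distinct ws" "set ws = labellings Q G"
    "\<And>j t. j < length ws \<Longrightarrow> t \<in> Q \<Longrightarrow>
      (\<exists>i<j. \<forall>v\<in>vert (min_face Q t). (ws ! i) v = (ws ! j) v) \<longleftrightarrow>
      \<not> {v \<in> vert Q. (ws ! j) v \<noteq> g} \<subseteq> min_face Q t"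
    "\<And>j. 0 < j \<Longrightarrow> j < length ws \<Longrightarrow> {v \<in> vert Q. (ws ! j) v \<noteq> g} \<noteq> {}"
proof -
  let ?L = "labellings Q G"
  define supp where "supp \<omega> = {v \<in> vert Q. \<omega> v \<noteq> g}" for \<omega> :: "'a \<Rightarrow> 'g"
  have supp_iff: "v \<in> supp \<omega> \<longleftrightarrow> v \<in> vert Q \<and> \<omega> v \<noteq> g" for v \<omega> by (simp add: supp_def)
  obtain xs where xs: "set xs = ?L" "distinct xs"
    using finite_distinct_list[OF finite_labellings[OF assms(1)]] by blast
  define ws where "ws = sort_key (\<lambda>\<omega>. card (supp \<omega>)) xs"
  have ws: "set ws = ?L" "distinct ws" using xs by (auto simp: ws_def)
  have sorted: "card (supp (ws ! i)) \<le> card (supp (ws ! j))" if "i < j" "j < length ws" for i j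
  proof -
    have "sorted (map (\<lambda>\<omega>. card (supp \<omega>)) ws)" by (simp add: ws_def)
    then show ?thesis using sorted_nth_mono[of "map (\<lambda>\<omega>. card (supp \<omega>)) ws" i j] that by simp
  qed
  have fin: "finite (supp \<omega>)" for \<omega>
    using finite_polyhedron_extreme_points[OF polytope_imp_polyhedron[OF Q]]
    by (auto simp: supp_def vert_def)
  have wsL: "ws ! i \<in> ?L" if "i < length ws" for i using that ws(1) nth_mem by blast
  \<comment> \<open>Otherwise the support of \<open>ws ! j\<close> lies in that of
    \<open>ws ! i\<close>, which is no larger, so the two supports are equal. The labellings agree
    there and are both \<open>g\<close> elsewhere, hence coincide.\<close>
  have not_sub: "\<not> supp (ws ! j) \<subseteq> supp (ws ! i) \<or> (\<exists>v\<in>supp (ws ! j). (ws ! i) v \<noteq> (ws ! j) v)"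
    if ij: "i < j" "j < length ws" for i j
  proof (rule ccontr)
    assume "\<not> ?thesis"
    then have *: "supp (ws ! j) \<subseteq> supp (ws ! i)" "\<And>v. v \<in> supp (ws ! j) \<Longrightarrow> (ws ! i) v = (ws ! j) v"
      by auto
    have "supp (ws ! j) = supp (ws ! i)"
      using card_seteq[OF fin *(1) sorted[OF ij]] .
    then have "(ws ! i) v = (ws ! j) v" if "v \<in> vert Q" for v
      using *(2)[of v] that by (metis supp_iff)
    then have "ws ! i = ws ! j"
      using PiE_ext[OF wsL[of i, unfolded labellings_def] wsL[of j, unfolded labellings_def]] ij
      by simp
    then show False using ws(2) ij by (simp add: nth_eq_iff_index_eq)
  qed
  have iff: "(\<exists>i<j. \<forall>v\<in>vert (min_face Q t). (ws ! i) v = (ws ! j) v) \<longleftrightarrow>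
      \<not> supp (ws ! j) \<subseteq> min_face Q t" if j: "j < length ws" and t: "t \<in> Q" for j t
  proof
    assume "\<exists>i<j. \<forall>v\<in>vert (min_face Q t). (ws ! i) v = (ws ! j) v"
    then obtain i where i: "i < j" "\<And>v. v \<in> vert (min_face Q t) \<Longrightarrow> (ws ! i) v = (ws ! j) v"
      by blast
    show "\<not> supp (ws ! j) \<subseteq> min_face Q t"
    proof
      assume "supp (ws ! j) \<subseteq> min_face Q t"
      then have "(ws ! i) v = (ws ! j) v" if "v \<in> supp (ws ! j)" for v
        using i(2)[of v] vert_face[OF min_face_face_of[OF Q t]] that supp_iff by blast
      moreover from this have "supp (ws ! j) \<subseteq> supp (ws ! i)" by (metis supp_iff subsetI)
      ultimately show False using not_sub[OF i(1) j] by blast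
    qed
  next
    assume "\<not> supp (ws ! j) \<subseteq> min_face Q t"
    then obtain v where v: "v \<in> supp (ws ! j)" "v \<notin> min_face Q t" by blast
    \<comment> \<open>As \<open>v\<close> is outside the minimal face, recolouring it is invisible
      at \<open>t\<close>; as it shrinks the support, the new labelling comes earlier.\<close>
    define \<nu> where "\<nu> = (ws ! j)(v := g)"
    have "\<nu> \<in> ?L"
      using wsL[OF j] v(1) assms(2) by (auto simp: \<nu>_def labellings_def supp_def PiE_iff extensional_def)
    then obtain i where i: "i < length ws" "ws ! i = \<nu>" using ws(1) by (metis in_set_conv_nth)
    have "supp \<nu> \<subset> supp (ws ! j)" using v(1) by (auto simp: supp_def \<nu>_def)
    then have "card (supp \<nu>) < card (supp (ws ! j))" by (intro psubset_card_mono fin)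
    then have "i < j" using sorted[of j i] i by (cases "i = j") force+
    moreover have "v \<notin> vert (min_face Q t)"
      using v(2) vert_face[OF min_face_face_of[OF Q t]] by blast
    ultimately show "\<exists>i<j. \<forall>v\<in>vert (min_face Q t). (ws ! i) v = (ws ! j) v"
      using i(2) by (auto simp: \<nu>_def)
  qed
  \<comment> \<open>With index \<open>0\<close> for the earlier labelling, an empty support would
    violate both alternatives of \<open>not_sub\<close>.\<close>
  have "supp (ws ! j) \<noteq> {}" if "0 < j" "j < length ws" for j
    using not_sub[OF that] by auto
  with iff ws that show thesis unfolding supp_def by blast
qed

text \<open>A face meeting the relative interior of \<open>convex hull S\<close> contains all of
  \<open>S\<close>, so the set \<open>S\<close> can be traded for a single point
  \<open>p\<close>.\<close>

lemma faces_not_containing_shape: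
  assumes S: "S \<subseteq> vert Q" "S \<noteq> {}"
  defines "A \<equiv> {t \<in> Q. \<not> S \<subseteq> min_face Q t}"
  shows "A = rel_frontier Q \<or> A \<subseteq> rel_frontier Q \<and> A \<noteq> {} \<and> contractible A"
proof -
  have cQ: "convex Q" using polytope_imp_convex[OF Q] .
  have SQ: "convex hull S \<subseteq> Q"
  proof (rule hull_minimal[where S = convex, OF _ cQ])
    show "S \<subseteq> Q" using S(1) unfolding vert_def extreme_point_of_def by blast
  qed
  obtain p where p: "p \<in> rel_interior (convex hull S)"
    using rel_interior_eq_empty[OF convex_convex_hull, of S] S(2) by auto
  then have pS: "p \<in> convex hull S" using rel_interior_subset by blast
  have A: "A = {t \<in> Q. p \<notin> min_face Q t}"
  proof -
    have "S \<subseteq> min_face Q t \<longleftrightarrow> p \<in> min_face Q t" if t: "t \<in> Q" for t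
    proof
      assume "S \<subseteq> min_face Q t"
      then have "convex hull S \<subseteq> min_face Q t"
        by (intro hull_minimal face_of_imp_convex[OF min_face_face_of[OF Q t]])
      then show "p \<in> min_face Q t" using pS by blast
    next
      assume "p \<in> min_face Q t"
      then have "convex hull S \<subseteq> min_face Q t"
        using p by (intro subset_of_face_of[OF min_face_face_of[OF Q t] SQ]) auto
      then show "S \<subseteq> min_face Q t" using hull_subset[of S convex] by (rule order_trans[rotated])
    qed
    then show ?thesis by (auto simp: A_def)
  qed
  have sub: "A \<subseteq> rel_frontier Q"
    using pS SQ unfolding A rel_frontier_polytope_eq[OF Q] by auto
  show ?thesis
  proof (cases "p \<in> rel_interior Q")
    case True
    \<comment> \<open>\<open>Q\<close> is the only face through a relative interior point, so all
      proper faces avoid \<open>p\<close>. When \<open>Q\<close> is a single point, \<open>A\<close>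
      and the frontier are both empty.\<close>
    have "min_face Q t = Q" if "t \<in> Q" "p \<in> min_face Q t" for t
      using face_of_imp_subset[OF min_face_face_of[OF Q that(1)]] True that(2)
        subset_of_face_of[OF min_face_face_of[OF Q that(1)] order_refl] by blast
    then have "A = rel_frontier Q"
      using sub unfolding A rel_frontier_polytope_eq[OF Q] by blast
    then show ?thesis ..
  next
    case False
    have "p \<in> Q" using pS SQ by blast
    with contractible_faces_avoiding_point[OF Q this False] sub show ?thesis
      unfolding A by blast
  qed
qed

end

section \<open>Assembling the shelling\<close>

theorem theorem5:
  fixes Q :: "'a::euclidean_space set" and d :: nat and G :: "'g set"
  assumes "polytope Q" and "aff_dim Q = int d" and "finite G"
  shows "\<exists>Cs. topological_shelling (rainbow_space Q G) (rainbow_cells Q G) Cs"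
proof -
  let ?Y = "rainbow_space Q G" and ?p = "rainbow_point Q G" and ?L = "labellings Q G"
  let ?C = "rainbow_cell Q G Q"
  note Q = assms(1)
  have Qne: "Q \<noteq> {}" using assms(2) by auto
  note QQ = face_of_refl[OF polytope_imp_convex[OF Q]]
  note complex = finite_regular_cell_complex_rainbow[OF Q assms(3)]
  note maximal = maximal_cells_rainbow[OF Q Qne, of G]
  show ?thesis
  proof (cases "?L = {}")
    case True
    \<comment> \<open>Since \<open>Q\<close> has a vertex, this is the case of no colours: there are
      no cells, and the empty list is a shelling.\<close>
    then have "topological_shelling ?Y (rainbow_cells Q G) []"
      using complex maximal by (simp add: topological_shelling_def)
    then show ?thesis ..
  next
    case False
    obtain v where "v extreme_point_of Q"
      using extreme_point_exists_convex[OF polytope_imp_compact[OF Q] polytope_imp_convex[OF Q] Qne] by blast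
    then obtain g where g: "g \<in> G" using False by (auto simp: labellings_def vert_def)
    obtain ws where ws: "distinct ws" "set ws = ?L"
      and iff: "\<And>j t. j < length ws \<Longrightarrow> t \<in> Q \<Longrightarrow>
        (\<exists>i<j. \<forall>v\<in>vert (min_face Q t). (ws ! i) v = (ws ! j) v) \<longleftrightarrow>
        \<not> {v \<in> vert Q. (ws ! j) v \<noteq> g} \<subseteq> min_face Q t"
      and ne: "\<And>j. 0 < j \<Longrightarrow> j < length ws \<Longrightarrow> {v \<in> vert Q. (ws ! j) v \<noteq> g} \<noteq> {}"
      using rainbow_labelling_order[OF Q assms(3) g] by blast
    have wsL: "ws ! i \<in> ?L" if "i < length ws" for i using that ws(2) nth_mem by blast
    let ?Cs = "map ?C ws"
    have inj: "inj_on ?C ?L"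
      using rainbow_cell_full_inj[OF Q _ _ QQ Qne] by (intro inj_onI) blast
    have shell: "let A = (\<Union>i<j. ?Cs ! i) \<inter> ?Cs ! j in
        A \<subseteq> cell_boundary ?Y (?Cs ! j) \<and> A \<noteq> {} \<and> contractible_space (subtopology ?Y A)
        \<or> A = cell_boundary ?Y (?Cs ! j)" if j: "0 < j" "j < length ws" for j
    proof -
      define S where "S = {v \<in> vert Q. (ws ! j) v \<noteq> g}"
      define A where "A = {t \<in> Q. \<not> S \<subseteq> min_face Q t}"
      have AQ: "A \<subseteq> Q" by (auto simp: A_def)
      \<comment> \<open>The intersection is pulled back to \<open>Q\<close> along the embedding of
        the \<open>j\<close>-th cell. Classes over different points of \<open>Q\<close> never
        coincide, so only labels at the same \<open>t\<close> are compared.\<close>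
      have "(\<Union>i<j. ?C (ws ! i)) \<inter> ?C (ws ! j) = ?p (ws ! j) ` A"
      proof -
        have "?p (ws ! j) t \<in> ?C (ws ! i) \<longleftrightarrow> (\<forall>v\<in>vert (min_face Q t). (ws ! i) v = (ws ! j) v)"
          if "i < j" "t \<in> Q" for i t
        proof -
          have L: "ws ! i \<in> ?L" "ws ! j \<in> ?L" using wsL that(1) j(2) by auto
          show ?thesis
            using rainbow_point_eq_iff[OF L(2,1) that(2)] that(2)
            unfolding rainbow_cell_eq by (auto simp: image_iff)
        qed
        then have "?p (ws ! j) t \<in> (\<Union>i<j. ?C (ws ! i)) \<longleftrightarrow> t \<in> A" if "t \<in> Q" for t
          using iff[OF j(2) that] that by (auto simp: A_def S_def)
        then show ?thesis using AQ by (auto simp: rainbow_cell_eq)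
      qed
      moreover have "(\<Union>i<j. ?Cs ! i) = (\<Union>i<j. ?C (ws ! i))" using j(2) by auto
      ultimately have I: "(\<Union>i<j. ?Cs ! i) \<inter> ?Cs ! j = ?p (ws ! j) ` A" using j(2) by simp
      have B: "cell_boundary ?Y (?Cs ! j) = ?p (ws ! j) ` rel_frontier Q"
        using rainbow_cell_structure(3)[OF Q QQ Qne wsL[OF j(2)]] j(2) by simp
      have "A = rel_frontier Q \<or> A \<subseteq> rel_frontier Q \<and> A \<noteq> {} \<and> contractible A"
        using faces_not_containing_shape[OF Q, of S] ne[OF j]
        unfolding A_def S_def by blast
      \<comment> \<open>The same embedding carries \<open>A\<close> homeomorphically onto the
        intersection, so contractibility can be decided in \<open>Q\<close>.\<close>
      moreover have "contractible A \<longleftrightarrow> contractible_space (subtopology ?Y (?p (ws ! j) ` A))"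
        using homeomorphic_map_rainbow_point[OF wsL[OF j(2)] AQ]
        by (metis contractible_space_top_of_set homeomorphic_map_imp_homeomorphic_space
            homeomorphic_space_contractibility)
      ultimately show ?thesis unfolding I B Let_def by blast
    qed
    have dim: "cell_dim ?Y (?C \<omega>) = nat (aff_dim Q)" if "\<omega> \<in> ?L" for \<omega>
      using rainbow_cell_structure(2)[OF Q QQ Qne that] .
    have "sorted_wrt (\<lambda>C D. cell_dim ?Y C \<ge> cell_dim ?Y D) ?Cs"
      using dim wsL by (auto simp: sorted_wrt_iff_nth_less)
    then have "topological_shelling ?Y (rainbow_cells Q G) ?Cs"
      unfolding topological_shelling_def
      using complex maximal inj ws shell by (simp add: distinct_map)
    then show ?thesis ..
  qed
qed

end
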